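(* Write points of $\mathbb{R}^4$ as $(p,q)$ with $p,q\in\mathbb{R}^2$, and let $u(p,q) = \frac12(|p|^2-|q|^2)$. Then $u$ is not $\Phi$-minimal on $\mathbb{R}^4$ for any uniformly elliptic integrand $\Phi$ on $\mathbb{S}^4\subset\mathbb{R}^5 = \{(p,q,z): p,q\in\mathbb{R}^2,\ z\in\mathbb{R}\}$ that depends only on $|p|$, $|q|$ and $z$.
   Context: An integrand on $\mathbb{S}^n \subset \mathbb{R}^{n+1}$ is a positive even function $\Phi \in C^{2,\alpha}(\mathbb{S}^n)$ for some $\alpha\in(0,1]$. It is identified with its one-homogeneous extension to $\mathbb{R}^{n+1}$, i.e. $\Phi(t\nu) = t\,\Phi(\nu)$ for $t \ge 0$, $\nu \in \mathbb{S}^n$. The integrand $\Phi$ is uniformly elliptic if this one-homogeneous extension has uniformly convex level sets, i.e. the hypersurface $\{\Phi = 1\}$ has all principal curvatures bounded below by a positive constant (equivalently, there is $\lambda > 0$ with $D^2\Phi(\nu)(\xi,\xi) \ge \lambda|\xi|^2$ for all $\nu \in \mathbb{S}^n$ and $\xi \perp \nu$). For an oriented hypersurface $\Sigma \subset \mathbb{R}^{n+1}$ with unit normal $\nu$, set $A_\Phi(\Sigma) = \int_\Sigma \Phi(\nu)$. If $\Sigma$ is the graph of a smooth function $u$ on a domain $\Omega \subset \mathbb{R}^n$, then $A_\Phi(\Sigma) = \int_\Omega \varphi(\nabla u)\,dx$ with $\varphi(y) := \Phi(-y,1)$, $y \in \mathbb{R}^n$. The function $u$ is called $\Phi$-minimal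 on $\Omega$ if its graph is a critical point of $A_\Phi$, i.e. $u$ solves $$\operatorname{div}(\nabla\varphi(\nabla u)) = \sum_{i,j=1}^n \varphi_{ij}(\nabla u)\,u_{ij} = 0 \quad \text{in } \Omega.$$ *)

theory Defs
  imports "HOL-Analysis.Analysis"
begin

definition dirderiv :: "('a::euclidean_space \<Rightarrow> real) \<Rightarrow> 'a \<Rightarrow> 'a \<Rightarrow> real" where
  "dirderiv f v x = frechet_derivative f (at x) v"

definition grad :: "('a::euclidean_space \<Rightarrow> real) \<Rightarrow> 'a \<Rightarrow> 'a" where
  "grad f x = (\<Sum>b\<in>Basis. dirderiv f b x *\<^sub>R b)"

definition divergence :: "('a::euclidean_space \<Rightarrow> 'a) \<Rightarrow> 'a \<Rightarrow> real" where
  "divergence X x = (\<Sum>b\<in>Basis. dirderiv (\<lambda>y. X y \<bullet> b) b x)"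

text \<open>The next predicate is meant for open sets \<open>S\<close>, since derivatives are taken in the full space.\<close>

primrec Ck_on :: "nat \<Rightarrow> ('a::euclidean_space \<Rightarrow> real) \<Rightarrow> 'a set \<Rightarrow> bool" where
  "Ck_on 0 f S \<longleftrightarrow> continuous_on S f"
| "Ck_on (Suc k) f S \<longleftrightarrow>
     (\<forall>x\<in>S. f differentiable (at x)) \<and> (\<forall>b\<in>Basis. Ck_on k (dirderiv f b) S)"

definition smooth_on :: "('a::euclidean_space \<Rightarrow> real) \<Rightarrow> 'a set \<Rightarrow> bool" where
  "smooth_on f S \<longleftrightarrow> (\<forall>k. Ck_on k f S)"

definition holder_on :: "real \<Rightarrow> ('a::euclidean_space \<Rightarrow> real) \<Rightarrow> 'a set \<Rightarrow> bool" where
  "holder_on \<alpha> f S \<longleftrightarrow> (\<exists>C. \<forall>x\<in>S. \<forall>y\<in>S. \<bar>f x - f y\<bar> \<le> C * dist x y powr \<alpha>)"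

text \<open>
  An integrand is represented by its one-homogeneous extension. Class \<open>C\<^sup>2\<^sup>,\<^sup>\<alpha>\<close> on the unit
  sphere is expressed through the extension: it is \<open>C\<^sup>2\<close> off the origin and its second partial
  derivatives, which are homogeneous of degree \<open>-1\<close>, are \<open>\<alpha>\<close>-Hoelder on the sphere.
\<close>

definition one_homogeneous :: "('a::euclidean_space \<Rightarrow> real) \<Rightarrow> bool" where
  "one_homogeneous \<Phi> \<longleftrightarrow> (\<forall>t\<ge>0. \<forall>\<nu>\<in>sphere 0 1. \<Phi> (t *\<^sub>R \<nu>) = t * \<Phi> \<nu>)"

definition C2_holder_sphere :: "real \<Rightarrow> ('a::euclidean_space \<Rightarrow> real) \<Rightarrow> bool" where
  "C2_holder_sphere \<alpha> \<Phi> \<longleftrightarrow>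
     Ck_on 2 \<Phi> (- {0}) \<and>
     (\<forall>b\<in>Basis. \<forall>c\<in>Basis. holder_on \<alpha> (dirderiv (dirderiv \<Phi> b) c) (sphere 0 1))"

definition integrand :: "('a::euclidean_space \<Rightarrow> real) \<Rightarrow> bool" where
  "integrand \<Phi> \<longleftrightarrow>
     one_homogeneous \<Phi> \<and>
     (\<forall>\<nu>\<in>sphere 0 1. \<Phi> \<nu> > 0) \<and>
     (\<forall>\<nu>\<in>sphere 0 1. \<Phi> (- \<nu>) = \<Phi> \<nu>) \<and>
     (\<exists>\<alpha>. 0 < \<alpha> \<and> \<alpha> \<le> 1 \<and> C2_holder_sphere \<alpha> \<Phi>)"

definition uniformly_elliptic :: "('a::euclidean_space \<Rightarrow> real) \<Rightarrow> bool" where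
  "uniformly_elliptic \<Phi> \<longleftrightarrow>
     (\<exists>c>0. \<forall>\<nu>\<in>sphere 0 1. \<forall>\<xi>. \<xi> \<bullet> \<nu> = 0 \<longrightarrow>
        dirderiv (dirderiv \<Phi> \<xi>) \<xi> \<nu> \<ge> c * (norm \<xi>)\<^sup>2)"

text \<open>\<open>(- \<nabla>u, 1)\<close> is the upward normal to the graph of \<open>u\<close>, scaled by the area element.\<close>

definition graph_density :: "('a::euclidean_space \<times> real \<Rightarrow> real) \<Rightarrow> 'a \<Rightarrow> real" where
  "graph_density \<Phi> y = \<Phi> (- y, 1)"

definition Phi_minimal_on ::
    "('a::euclidean_space \<times> real \<Rightarrow> real) \<Rightarrow> ('a \<Rightarrow> real) \<Rightarrow> 'a set \<Rightarrow> bool" where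
  "Phi_minimal_on \<Phi> u \<Omega> \<longleftrightarrow>
     smooth_on u \<Omega> \<and>
     (\<forall>x\<in>\<Omega>. divergence (\<lambda>y. grad (graph_density \<Phi>) (grad u y)) x = 0)"

lemma frechet_grad:
  assumes "f differentiable (at x)"
  shows "frechet_derivative f (at x) h = (\<Sum>c\<in>Basis. dirderiv f c x * (h \<bullet> c))"
proof -
  have lin: "linear (frechet_derivative f (at x))"
    using assms by (rule linear_frechet_derivative)
  have "frechet_derivative f (at x) h = frechet_derivative f (at x) (\<Sum>c\<in>Basis. (h \<bullet> c) *\<^sub>R c)"
    by (simp add: euclidean_representation)
  also have "\<dots> = (\<Sum>c\<in>Basis. dirderiv f c x * (h \<bullet> c))"
    by (simp add: linear_sum[OF lin] linear_scale[OF lin] dirderiv_def mult.commute)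
  finally show ?thesis .
qed

text \<open>The divergence form agrees with the expanded form of the equation.\<close>

lemma divergence_grad_grad:
  fixes \<phi> u :: "'a::euclidean_space \<Rightarrow> real"
  assumes \<phi>: "Ck_on 2 \<phi> UNIV" and u: "Ck_on 2 u \<Omega>" and x: "x \<in> \<Omega>"
  shows "divergence (\<lambda>y. grad \<phi> (grad u y)) x =
    (\<Sum>i\<in>Basis. \<Sum>j\<in>Basis. dirderiv (dirderiv \<phi> i) j (grad u x) * dirderiv (dirderiv u j) i x)"
proof -
  have g: "(grad u has_derivative
      (\<lambda>h. \<Sum>j\<in>Basis. frechet_derivative (dirderiv u j) (at x) h *\<^sub>R j)) (at x)"
  proof -
    have "(dirderiv u j has_derivative frechet_derivative (dirderiv u j) (at x)) (at x)"
      if "j \<in> Basis" for j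
      using u x that by (simp add: numeral_2_eq_2 flip: frechet_derivative_works)
    then show ?thesis
      unfolding grad_def by (auto intro!: derivative_eq_intros)
  qed
  have "dirderiv (\<lambda>y. grad \<phi> (grad u y) \<bullet> i) i x =
      (\<Sum>j\<in>Basis. dirderiv (dirderiv \<phi> i) j (grad u x) * dirderiv (dirderiv u j) i x)"
    if i: "i \<in> Basis" for i
  proof -
    have d: "dirderiv \<phi> i differentiable (at (grad u x))"
      using \<phi> i by (simp add: numeral_2_eq_2)
    have "(\<lambda>y. grad \<phi> (grad u y) \<bullet> i) = dirderiv \<phi> i \<circ> grad u"
      using i by (auto simp: grad_def fun_eq_iff inner_sum_left inner_Basis if_distrib
          sum.delta cong: if_cong)
    moreover have "(dirderiv \<phi> i \<circ> grad u has_derivative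
        frechet_derivative (dirderiv \<phi> i) (at (grad u x)) \<circ>
        (\<lambda>h. \<Sum>j\<in>Basis. frechet_derivative (dirderiv u j) (at x) h *\<^sub>R j)) (at x)"
      using d g by (intro diff_chain_at) (simp_all flip: frechet_derivative_works)
    ultimately have "dirderiv (\<lambda>y. grad \<phi> (grad u y) \<bullet> i) i x =
        frechet_derivative (dirderiv \<phi> i) (at (grad u x))
          (\<Sum>j\<in>Basis. dirderiv (dirderiv u j) i x *\<^sub>R j)"
      by (simp add: dirderiv_def frechet_derivative_at[symmetric])
    then show ?thesis
      by (simp add: frechet_grad[OF d] inner_sum_left inner_Basis if_distrib sum.delta cong: if_cong)
  qed
  then show ?thesis by (simp add: divergence_def)
qed

type_synonym R4 = "(real^2) \<times> (real^2)"

definition depends_on_radii :: "(R4 \<times> real \<Rightarrow> real) \<Rightarrow> bool" where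
  "depends_on_radii \<Phi> \<longleftrightarrow>
     (\<exists>F :: real \<Rightarrow> real \<Rightarrow> real \<Rightarrow> real. \<forall>p q z. \<Phi> ((p, q), z) = F (norm p) (norm q) z)"

lemma Ck_on_const: "Ck_on k (\<lambda>x. c) S"
  by (induction k arbitrary: c) (auto simp: dirderiv_def[abs_def])

lemma Ck_on_linear:
  fixes L :: "'a::euclidean_space \<Rightarrow> real"
  assumes "linear L"
  shows "Ck_on k L S"
proof -
  have bl: "bounded_linear L"
    using assms by (simp add: linear_conv_bounded_linear)
  have "dirderiv L b = (\<lambda>x. L b)" for b
    using frechet_derivative_at[OF bounded_linear_imp_has_derivative[OF bl]]
    by (auto simp: dirderiv_def fun_eq_iff)
  then show ?thesis
    using bl by (cases k) (auto simp: Ck_on_const linear_continuous_on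
        intro: bounded_linear_imp_differentiable)
qed

text \<open>The smoothness clause in \<open>Phi_minimal_on\<close> is satisfied by the quadratic \<open>u\<close> of interest.\<close>

lemma smooth_on_quad:
  "smooth_on (\<lambda>(p, q). ((norm p)\<^sup>2 - (norm q)\<^sup>2) / 2) (S :: R4 set)"
proof -
  define quad :: "R4 \<Rightarrow> real" where "quad = (\<lambda>(p, q). ((norm p)\<^sup>2 - (norm q)\<^sup>2) / 2)"
  have D: "(quad has_derivative (\<lambda>h. fst x \<bullet> fst h - snd x \<bullet> snd h)) (at x)" for x
    unfolding quad_def case_prod_beta power2_norm_eq_inner
    by (auto intro!: derivative_eq_intros simp: inner_commute field_simps)
  have "dirderiv quad b = (\<lambda>x. fst x \<bullet> fst b - snd x \<bullet> snd b)" for b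
    unfolding dirderiv_def frechet_derivative_at[OF D, symmetric] ..
  moreover have "linear (\<lambda>x::R4. fst x \<bullet> fst b - snd x \<bullet> snd b)" for b :: R4
    by (auto intro!: linearI simp: algebra_simps inner_add_left)
  ultimately have "Ck_on k (dirderiv quad b) S" for k b
    by (simp add: Ck_on_linear)
  moreover have dif: "quad differentiable (at x)" for x
    unfolding differentiable_def using D[of x] by blast
  moreover have "continuous_on S quad"
    using dif by (meson continuous_at_imp_continuous_on differentiable_imp_continuous_within)
  ultimately have "Ck_on k quad S" for k
    by (cases k) auto
  then show ?thesis by (simp add: smooth_on_def quad_def)
qed

end

theory Submission
  imports Defs
begin

text \<open>
  For this \<open>u\<close> the gradient map is a bijection and the Hessian is constant, so minimality says that
  \<open>\<Phi>(\<cdot>, 1)\<close> solves the ultrahyperbolic equation \<open>\<Delta>\<^sub>p = \<Delta>\<^sub>q\<close>. Second derivatives of \<open>\<Phi>\<close> are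
  homogeneous of degree \<open>-1\<close>, so blowing down shows that \<open>\<Phi>(\<cdot>, 0)\<close> solves the same equation
  off the origin. Being one-homogeneous and a function of \<open>\<bar>p\<bar>\<close> and \<open>\<bar>q\<bar>\<close> alone, \<open>\<Phi>(\<cdot>, 0)\<close> is
  determined by \<open>g(x) = \<Phi>(x e\<^sub>1, e\<^sub>1, 0)\<close>, which satisfies
  \<open>(1 - x\<^sup>2) g'' + (x + 1/x) g' - g = 0\<close>. This equation is singular on the light cone \<open>x = 1\<close>,
  where its \<open>C\<^sup>2\<close> solutions must vanish, contradicting \<open>\<Phi> > 0\<close>.
\<close>

section \<open>Directional derivatives along curves, under scaling and under rotation\<close>

lemma has_derivative_dirderiv:
  "f differentiable (at x) \<Longrightarrow> (f has_derivative (\<lambda>v. dirderiv f v x)) (at x)"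
  unfolding dirderiv_def using frechet_derivative_works by blast

lemma dirderiv_eqI:
  "(f has_derivative f') (at x) \<Longrightarrow> dirderiv f v x = f' v"
  unfolding dirderiv_def using frechet_derivative_at by metis

lemma dirderiv_linear:
  assumes "f differentiable (at x)"
  shows "linear (\<lambda>v. dirderiv f v x)"
  using linear_frechet_derivative[OF assms] by (simp add: dirderiv_def)

lemma DERIV_along_curve:
  fixes f :: "'a::euclidean_space \<Rightarrow> real"
  assumes "f differentiable (at (\<gamma> t))" and "(\<gamma> has_vector_derivative v) (at t)"
  shows "((\<lambda>t. f (\<gamma> t)) has_real_derivative dirderiv f v (\<gamma> t)) (at t)"
proof -
  have "((f \<circ> \<gamma>) has_derivative (\<lambda>v. dirderiv f v (\<gamma> t)) \<circ> (\<lambda>h. h *\<^sub>R v)) (at t)"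
    using assms by (intro diff_chain_at has_derivative_dirderiv)
      (auto simp: has_vector_derivative_def)
  then show ?thesis
    by (simp add: has_field_derivative_def o_def linear_scale[OF dirderiv_linear[OF assms(1)]] mult_commute_abs)
qed

text \<open>Both sides of \<open>eq\<close> are differentiated near \<open>x\<close>, the left one
  by the chain rule. With \<open>c = r\<close> this treats functions of degree one, with
  \<open>c = 1\<close> their first derivatives.\<close>

lemma dirderiv_scaled:
  fixes f :: "'a::euclidean_space \<Rightarrow> real"
  assumes "open S" "x \<in> S" and eq: "\<And>y. y \<in> S \<Longrightarrow> f (r *\<^sub>R y) = c * f y"
    and "f differentiable (at x)" "f differentiable (at (r *\<^sub>R x))"
  shows "r * dirderiv f v (r *\<^sub>R x) = c * dirderiv f v x"
proof -
  have "((f \<circ> (\<lambda>y. r *\<^sub>R y)) has_derivative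
      (\<lambda>v. dirderiv f v (r *\<^sub>R x)) \<circ> (\<lambda>h. r *\<^sub>R h)) (at x)"
    using assms by (intro diff_chain_at has_derivative_dirderiv)
      (auto intro!: derivative_eq_intros)
  then have "((\<lambda>y. c * f y) has_derivative
      (\<lambda>v. dirderiv f v (r *\<^sub>R x)) \<circ> (\<lambda>h. r *\<^sub>R h)) (at x)"
    by (rule has_derivative_transform_within_open[OF _ assms(1,2)]) (simp add: eq)
  moreover have "((\<lambda>y. c * f y) has_derivative (\<lambda>v. c * dirderiv f v x)) (at x)"
    using assms by (intro has_derivative_mult_right has_derivative_dirderiv)
  ultimately have "(\<lambda>v. dirderiv f v (r *\<^sub>R x)) \<circ> (\<lambda>h. r *\<^sub>R h) = (\<lambda>v. c * dirderiv f v x)"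
    by (rule has_derivative_unique)
  then show ?thesis
    by (simp add: fun_eq_iff linear_scale[OF dirderiv_linear[OF assms(5)]])
qed

text \<open>The difference quotient at \<open>a\<close> is \<open>k\<close> itself, so continuity of
  \<open>k\<close> suffices. This stands in for the product rule when \<open>k\<close> involves a
  merely continuous second derivative.\<close>

lemma DERIV_mult_self_at_0:
  fixes k :: "real \<Rightarrow> real"
  assumes "isCont k a"
  shows "((\<lambda>h. (h - a) * k h) has_real_derivative k a) (at a)"
  unfolding DERIV_caratheodory_within using assms by (auto intro!: exI[of _ k] simp: mult.commute)

text \<open>The Hessian of a radial function in a tangential direction is the radial derivative
  divided by the radius. Here \<open>a\<close> is radial, \<open>b\<close> tangential,
  \<open>s\<close> the radius, and \<open>c\<close> the component fixed by the rotation.\<close>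

lemma dirderiv2_rotation_invariant:
  fixes f :: "'a::euclidean_space \<Rightarrow> real"
  assumes s: "s \<noteq> 0"
    and inv: "\<And>h \<theta>. f (c + cos \<theta> *\<^sub>R (s *\<^sub>R a + h *\<^sub>R b) + sin \<theta> *\<^sub>R (s *\<^sub>R b - h *\<^sub>R a)) =
      f (c + s *\<^sub>R a + h *\<^sub>R b)"
    and diff: "\<And>h. f differentiable (at (c + s *\<^sub>R a + h *\<^sub>R b))"
    and diffa: "dirderiv f a differentiable (at (c + s *\<^sub>R a))"
    and diffb: "dirderiv f b differentiable (at (c + s *\<^sub>R a))"
  shows "dirderiv (dirderiv f b) b (c + s *\<^sub>R a) = dirderiv f a (c + s *\<^sub>R a) / s"
proof -
  define \<gamma> where "\<gamma> = (\<lambda>h. c + s *\<^sub>R a + h *\<^sub>R b)"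
  \<comment> \<open>\<open>f\<close> is constant on the orbit \<open>?\<beta>\<close> of
    \<open>\<gamma> h\<close>, whose velocity at angle 0 is
    \<open>s *\<^sub>R b - h *\<^sub>R a\<close>. Differentiating the resulting identity in
    \<open>h\<close> at 0 then gives the claim.\<close>
  have tangential: "s * dirderiv f b (\<gamma> h) = h * dirderiv f a (\<gamma> h)" for h
  proof -
    let ?\<beta> = "\<lambda>\<theta>. c + cos \<theta> *\<^sub>R (s *\<^sub>R a + h *\<^sub>R b) + sin \<theta> *\<^sub>R (s *\<^sub>R b - h *\<^sub>R a)"
    have "((\<lambda>\<theta>. f (?\<beta> \<theta>)) has_real_derivative dirderiv f (s *\<^sub>R b - h *\<^sub>R a) (?\<beta> 0)) (at 0)"
      using diff[of h]
      by (intro DERIV_along_curve) (auto intro!: derivative_eq_intros simp: add.assoc)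
    then have "((\<lambda>\<theta>. f (\<gamma> h)) has_real_derivative
        dirderiv f (s *\<^sub>R b - h *\<^sub>R a) (\<gamma> h)) (at (0::real))"
      unfolding inv by (simp add: \<gamma>_def add.assoc)
    then have "dirderiv f (s *\<^sub>R b - h *\<^sub>R a) (\<gamma> h) = 0"
      using DERIV_unique DERIV_const by blast
    moreover have lin: "linear (\<lambda>v. dirderiv f v (\<gamma> h))"
      using diff by (intro dirderiv_linear) (simp add: \<gamma>_def)
    ultimately show ?thesis
      by (simp add: linear_diff[OF lin] linear_scale[OF lin])
  qed
  have \<gamma>: "(\<gamma> has_vector_derivative b) (at 0)" "\<gamma> 0 = c + s *\<^sub>R a"
    unfolding \<gamma>_def by (auto intro!: derivative_eq_intros)
  have "isCont (\<lambda>h. dirderiv f a (\<gamma> h) / s) 0"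
    using DERIV_along_curve[of "dirderiv f a" \<gamma> 0 b] diffa \<gamma> s
    by (intro continuous_intros DERIV_isCont) auto
  then have "((\<lambda>h. (h - 0) * (dirderiv f a (\<gamma> h) / s)) has_real_derivative
      dirderiv f a (\<gamma> 0) / s) (at 0)"
    by (rule DERIV_mult_self_at_0)
  moreover have "(\<lambda>h. (h - 0) * (dirderiv f a (\<gamma> h) / s)) = (\<lambda>h. dirderiv f b (\<gamma> h))"
    using tangential s by (simp add: fun_eq_iff field_simps)
  moreover have "((\<lambda>h. dirderiv f b (\<gamma> h)) has_real_derivative
      dirderiv (dirderiv f b) b (\<gamma> 0)) (at 0)"
    using diffb \<gamma> by (intro DERIV_along_curve) auto
  ultimately show ?thesis
    using DERIV_unique \<gamma>(2) by metis
qed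

text \<open>
  The equation has a regular singular point at \<open>1\<close> with indices \<open>0\<close> and \<open>2\<close>, and the solutions
  with \<open>g 1 \<noteq> 0\<close> carry a term \<open>(x - 1)\<^sup>2 * ln \<bar>x - 1\<bar>\<close>; hence they are not \<open>C\<^sup>2\<close>.
\<close>

lemma C2_solution_vanishes_at_1:
  fixes g g' g'' :: "real \<Rightarrow> real"
  assumes g: "(g has_real_derivative g' 1) (at 1)"
    and g': "(g' has_real_derivative g'' 1) (at 1)"
    and g'': "isCont g'' 1"
    and ode: "\<And>x. x > 0 \<Longrightarrow> (1 - x\<^sup>2) * g'' x + (x + 1 / x) * g' x - g x = 0"
  shows "g 1 = 0"
proof -
  \<comment> \<open>The equation reads (x - 1) (x + 1) g'' = (x + 1/x) g' - g. Differentiating both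
    sides at 1 gives 2 g''(1) = 2 g''(1) - g'(1), so g'(1) = 0, and the equation at 1, 2 g'(1) =
    g(1), finishes. The left side is differentiated without a derivative of g''.\<close>
  have "((\<lambda>x. (x - 1) * ((x + 1) * g'' x)) has_real_derivative (1 + 1) * g'' 1) (at 1)"
    using g'' by (intro DERIV_mult_self_at_0) (auto intro!: continuous_intros)
  then have "((\<lambda>x. (x + 1 / x) * g' x - g x) has_real_derivative (1 + 1) * g'' 1) (at 1)"
  proof (rule has_field_derivative_transform_within_open[of _ _ _ "{0<..}"])
    fix x :: real assume "x \<in> {0<..}"
    then show "(x - 1) * ((x + 1) * g'' x) = (x + 1 / x) * g' x - g x"
      using ode[of x] by (simp add: algebra_simps power2_eq_square)
  qed auto
  moreover have "((\<lambda>x. (x + 1 / x) * g' x - g x) has_real_derivative 2 * g'' 1 - g' 1) (at 1)"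
    by (auto intro!: derivative_eq_intros g g')
  ultimately have "(1 + 1) * g'' 1 = 2 * g'' 1 - g' 1"
    by (rule DERIV_unique)
  with ode[of 1] show ?thesis by simp
qed

section \<open>Consequences of one-homogeneity\<close>

lemma Ck_on_2D:
  assumes "Ck_on 2 f S" "x \<in> S"
  shows "f differentiable (at x)"
    and "b \<in> Basis \<Longrightarrow> dirderiv f b differentiable (at x)"
    and "b \<in> Basis \<Longrightarrow> c \<in> Basis \<Longrightarrow> continuous_on S (dirderiv (dirderiv f b) c)"
  using assms by (auto simp: numeral_2_eq_2)

lemma one_homogeneousD:
  assumes "one_homogeneous \<Phi>" "t \<ge> 0"
  shows "\<Phi> (t *\<^sub>R x) = t * \<Phi> x"
proof (cases "x = 0")
  case True
  \<comment> \<open>The definition speaks of unit vectors only; scaling one of them by 0 yields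
    \<open>\<Phi> 0 = 0\<close>.\<close>
  obtain b :: 'a where "b \<in> Basis" using nonempty_Basis by blast
  then have "\<Phi> (0 *\<^sub>R b) = 0 * \<Phi> b"
    using assms(1) unfolding one_homogeneous_def by (metis norm_Basis mem_sphere_0 order_refl)
  then show ?thesis using True by simp
next
  case False
  define \<nu> where "\<nu> = x /\<^sub>R norm x"
  have \<nu>: "\<nu> \<in> sphere 0 1" "x = norm x *\<^sub>R \<nu>"
    using False by (simp_all add: \<nu>_def)
  have "\<Phi> ((t * norm x) *\<^sub>R \<nu>) = (t * norm x) * \<Phi> \<nu>" "\<Phi> (norm x *\<^sub>R \<nu>) = norm x * \<Phi> \<nu>"
    using assms \<nu>(1) unfolding one_homogeneous_def by (auto simp del: scaleR_scaleR)
  then show ?thesis using \<nu>(2) by (metis mult.assoc scaleR_scaleR)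
qed

context
  fixes \<Phi> :: "'a::euclidean_space \<Rightarrow> real"
  assumes hom: "one_homogeneous \<Phi>" and C2: "Ck_on 2 \<Phi> (- {0})"
begin

lemma dirderiv_homogeneous:
  assumes "t > 0" "x \<noteq> 0"
  shows "dirderiv \<Phi> v (t *\<^sub>R x) = dirderiv \<Phi> v x"
  using dirderiv_scaled[of UNIV x \<Phi> t t v] one_homogeneousD[OF hom, of t] assms
    Ck_on_2D(1)[OF C2] by simp

lemma dirderiv2_homogeneous:
  assumes "t > 0" "x \<noteq> 0" "b \<in> Basis"
  shows "dirderiv (dirderiv \<Phi> b) v (t *\<^sub>R x) = dirderiv (dirderiv \<Phi> b) v x / t"
  using dirderiv_scaled[of "-{0}" x "dirderiv \<Phi> b" t 1 v] dirderiv_homogeneous[of t _ b] assms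
    Ck_on_2D(2)[OF C2] by (simp add: field_simps open_Compl)

lemma euler_homogeneous:
  assumes "x \<noteq> 0"
  shows "dirderiv \<Phi> x x = \<Phi> x"
proof -
  have "((\<lambda>t. \<Phi> (t *\<^sub>R x)) has_real_derivative dirderiv \<Phi> x (1 *\<^sub>R x)) (at 1)"
    using Ck_on_2D(1)[OF C2] assms
    by (intro DERIV_along_curve) (auto intro!: derivative_eq_intros)
  then have "((\<lambda>t. t * \<Phi> x) has_real_derivative dirderiv \<Phi> x (1 *\<^sub>R x)) (at 1)"
    by (rule has_field_derivative_transform_within_open[of _ _ _ "{0<..}"])
      (simp_all add: one_homogeneousD[OF hom])
  moreover have "((\<lambda>t. t * \<Phi> x) has_real_derivative \<Phi> x) (at 1)"
    by (auto intro!: derivative_eq_intros)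
  ultimately have "dirderiv \<Phi> x (1 *\<^sub>R x) = \<Phi> x"
    by (rule DERIV_unique)
  then show ?thesis by simp
qed

end

section \<open>Derivatives of the graph density\<close>

lemma dirderiv_minus:
  assumes "f differentiable (at x)"
  shows "dirderiv (\<lambda>y. - f y) v x = - dirderiv f v x"
  by (intro dirderiv_eqI[of _ "\<lambda>v. - dirderiv f v x"] has_derivative_minus
      has_derivative_dirderiv assms)

lemma graph_density_has_derivative:
  assumes "\<Phi> differentiable (at (- y, 1))"
  shows "(graph_density \<Phi> has_derivative (\<lambda>v. - dirderiv \<Phi> (v, 0) (- y, 1))) (at y)"
proof -
  have "((\<Phi> \<circ> (\<lambda>y. (- y, 1))) has_derivative
      (\<lambda>v. dirderiv \<Phi> v (- y, 1)) \<circ> (\<lambda>h. (- h, 0))) (at y)"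
    using assms by (intro diff_chain_at has_derivative_dirderiv has_derivative_Pair)
      (auto intro!: derivative_eq_intros)
  moreover have "dirderiv \<Phi> (- v, 0) (- y, 1) = - dirderiv \<Phi> (v, 0) (- y, 1)" for v
    using linear_neg[OF dirderiv_linear[OF assms], of "(v, 0)"] by simp
  ultimately show ?thesis
    by (simp add: o_def graph_density_def[abs_def])
qed

text \<open>The points \<open>(- y, 1)\<close> avoid the origin, so regularity holds on the whole
  space. The two signs coming from \<open>- y\<close> cancel in the second derivatives.\<close>

lemma graph_density_C2:
  fixes \<Phi> :: "'a::euclidean_space \<times> real \<Rightarrow> real"
  assumes C2: "Ck_on 2 \<Phi> (- {0})"
  shows dirderiv2_graph_density: "i \<in> Basis \<Longrightarrow>
      dirderiv (dirderiv (graph_density \<Phi>) i) j y = dirderiv (dirderiv \<Phi> (i, 0)) (j, 0) (- y, 1)"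
    and Ck_on_graph_density: "Ck_on 2 (graph_density \<Phi>) UNIV"
proof -
  have nz: "(- y, 1::real) \<in> - {0}" for y :: 'a
    by (simp add: zero_prod_def)
  note D = graph_density_has_derivative[OF Ck_on_2D(1)[OF C2 nz]]
  \<comment> \<open>A first derivative is minus the graph density of a derivative of
    \<open>\<Phi>\<close>, so \<open>graph_density_has_derivative\<close> applies a second
    time.\<close>
  have 1: "dirderiv (graph_density \<Phi>) i = (\<lambda>y. - graph_density (dirderiv \<Phi> (i, 0)) y)" for i
    using dirderiv_eqI[OF D] by (auto simp: graph_density_def)
  have B: "(i, 0) \<in> Basis" if "i \<in> Basis" for i :: 'a
    using that by (simp add: Basis_prod_def)
  note D' = graph_density_has_derivative[OF Ck_on_2D(2)[OF C2 nz B]]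
  have diff': "graph_density (dirderiv \<Phi> (i, 0)) differentiable (at y)" if "i \<in> Basis" for i y
    using D'[OF that] differentiable_def by blast
  have 2: "dirderiv (dirderiv (graph_density \<Phi>) i) j y =
      dirderiv (dirderiv \<Phi> (i, 0)) (j, 0) (- y, 1)" if "i \<in> Basis" for i j y
    unfolding 1 dirderiv_minus[OF diff'[OF that]] dirderiv_eqI[OF D'[OF that]] by simp
  then show "i \<in> Basis \<Longrightarrow>
      dirderiv (dirderiv (graph_density \<Phi>) i) j y = dirderiv (dirderiv \<Phi> (i, 0)) (j, 0) (- y, 1)" .
  have "continuous_on UNIV (dirderiv (dirderiv (graph_density \<Phi>) i) j)"
    if "i \<in> Basis" "j \<in> Basis" for i j
  proof -
    have "continuous_on UNIV (\<lambda>y. dirderiv (dirderiv \<Phi> (i, 0)) (j, 0) (- y, 1))"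
      using nz that
      by (intro continuous_on_compose2[OF Ck_on_2D(3)[OF C2 nz]] B continuous_intros) auto
    then show ?thesis using 2[OF that(1)] by (simp add: fun_eq_iff cong: continuous_on_cong)
  qed
  moreover have "dirderiv (graph_density \<Phi>) i differentiable (at y)" if "i \<in> Basis" for i y
    unfolding 1 using diff'[OF that] by simp
  moreover have "graph_density \<Phi> differentiable (at y)" for y
    using D differentiable_def by blast
  ultimately show "Ck_on 2 (graph_density \<Phi>) UNIV"
    by (simp add: numeral_2_eq_2)
qed

section \<open>The equation satisfied by the integrand when the quadratic is minimal\<close>

lemma quadratic_derivatives:
  fixes u :: "R4 \<Rightarrow> real"
  defines "u \<equiv> \<lambda>(p, q). ((norm p)\<^sup>2 - (norm q)\<^sup>2) / 2"
  shows grad_quadratic: "grad u x = (fst x, - snd x)"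
    and dirderiv2_quadratic: "dirderiv (dirderiv u b) c x = fst b \<bullet> fst c - snd b \<bullet> snd c"
proof -
  have "(u has_derivative (\<lambda>h. fst x \<bullet> fst h - snd x \<bullet> snd h)) (at x)" for x
    unfolding u_def case_prod_beta power2_norm_eq_inner
    by (auto intro!: derivative_eq_intros simp: inner_commute field_simps)
  then have 1: "dirderiv u b = (\<lambda>x. fst x \<bullet> fst b - snd x \<bullet> snd b)" for b
    using dirderiv_eqI by blast
  have "grad u x = (\<Sum>b\<in>Basis. ((fst x, - snd x) \<bullet> b) *\<^sub>R b)"
    by (simp add: grad_def 1 inner_prod_def)
  then show "grad u x = (fst x, - snd x)"
    by (simp only: euclidean_representation)
  show "dirderiv (dirderiv u b) c x = fst b \<bullet> fst c - snd b \<bullet> snd c"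
    unfolding 1
    by (subst dirderiv_eqI[where f' = "\<lambda>x. fst x \<bullet> fst b - snd x \<bullet> snd b"])
      (auto intro!: derivative_eq_intros simp: inner_commute)
qed

lemma Phi_minimal_quadratic_imp_ultrahyperbolic:
  fixes \<Phi> :: "R4 \<times> real \<Rightarrow> real"
  assumes C2: "Ck_on 2 \<Phi> (- {0})"
    and min: "Phi_minimal_on \<Phi> (\<lambda>(p, q). ((norm p)\<^sup>2 - (norm q)\<^sup>2) / 2) UNIV"
  shows "(\<Sum>b\<in>Basis. dirderiv (dirderiv \<Phi> ((b, 0), 0)) ((b, 0), 0) (y, 1)) =
    (\<Sum>b\<in>Basis. dirderiv (dirderiv \<Phi> ((0, b), 0)) ((0, b), 0) (y, 1))"
proof -
  define u :: "R4 \<Rightarrow> real" where "u = (\<lambda>(p, q). ((norm p)\<^sup>2 - (norm q)\<^sup>2) / 2)"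
  \<comment> \<open>This choice makes \<open>grad u x = - y\<close>, so that the second derivatives
    of \<open>\<Phi>\<close> are evaluated at \<open>(y, 1)\<close>.\<close>
  define x where "x = (- fst y, snd y)"
  let ?D = "\<lambda>i j. dirderiv (dirderiv \<Phi> (i, 0)) (j, 0) (y, 1)"
  have Basis_sum: "(\<Sum>i\<in>Basis. h i) = (\<Sum>b\<in>Basis. h (b, 0)) + (\<Sum>b\<in>Basis. h (0, b))"
    for h :: "R4 \<Rightarrow> real"
    unfolding Basis_prod_def
    by (subst sum.union_disjoint) (auto simp: sum.reindex inj_on_def)
  have "Ck_on 2 u UNIV"
    using smooth_on_quad unfolding smooth_on_def u_def by blast
  then have "divergence (\<lambda>y. grad (graph_density \<Phi>) (grad u y)) x =
    (\<Sum>i\<in>Basis. \<Sum>j\<in>Basis. dirderiv (dirderiv (graph_density \<Phi>) i) j (grad u x) *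
      dirderiv (dirderiv u j) i x)"
    by (intro divergence_grad_grad Ck_on_graph_density C2) auto
  also have "\<dots> = (\<Sum>i\<in>Basis. \<Sum>j\<in>Basis. ?D i j * (fst j \<bullet> fst i - snd j \<bullet> snd i))"
    by (simp add: dirderiv2_graph_density[OF C2] grad_quadratic dirderiv2_quadratic u_def x_def)
  \<comment> \<open>The Hessian of \<open>u\<close> is diagonal with entries 1, 1, -1, -1, so only
    the pure second derivatives survive.\<close>
  also have "\<dots> = (\<Sum>b\<in>Basis. ?D (b, 0) (b, 0)) - (\<Sum>b\<in>Basis. ?D (0, b) (0, b))"
    by (simp add: Basis_sum inner_Basis if_distrib sum_negf cong: if_cong)
  finally show ?thesis
    using min by (simp add: Phi_minimal_on_def u_def x_def)
qed

section \<open>Rotations of the plane and the limit equation on z = 0\<close>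

lemma Basis_real2: "(Basis :: (real^2) set) = {axis 1 1, axis 2 1}"
  unfolding Basis_vec_def by (auto simp: UNIV_2)

text \<open>The left vector is (s, h) rotated by theta. Written in this form it supplies the
  invariance hypothesis of \<open>dirderiv2_rotation_invariant\<close>.\<close>

lemma norm_rotation:
  "norm (cos \<theta> *\<^sub>R (s *\<^sub>R axis 1 1 + h *\<^sub>R axis 2 1) +
      sin \<theta> *\<^sub>R (s *\<^sub>R axis 2 1 - h *\<^sub>R axis 1 1) :: real^2) =
    norm (s *\<^sub>R axis 1 1 + h *\<^sub>R axis 2 1 :: real^2)"
proof -
  have "(cos \<theta> * s - sin \<theta> * h)\<^sup>2 + (cos \<theta> * h + sin \<theta> * s)\<^sup>2 =
      ((cos \<theta>)\<^sup>2 + (sin \<theta>)\<^sup>2) * (s\<^sup>2 + h\<^sup>2)"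
    by algebra
  then show ?thesis
    by (simp add: norm_eq inner_vec_def sum_2 axis_def power2_eq_square)
qed

lemma ultrahyperbolic_at_infinity:
  fixes \<Phi> :: "R4 \<times> real \<Rightarrow> real"
  assumes hom: "one_homogeneous \<Phi>" and C2: "Ck_on 2 \<Phi> (- {0})"
    and min: "Phi_minimal_on \<Phi> (\<lambda>(p, q). ((norm p)\<^sup>2 - (norm q)\<^sup>2) / 2) UNIV"
    and "y \<noteq> 0"
  shows "(\<Sum>b\<in>Basis. dirderiv (dirderiv \<Phi> ((b, 0), 0)) ((b, 0), 0) (y, 0)) =
    (\<Sum>b\<in>Basis. dirderiv (dirderiv \<Phi> ((0, b), 0)) ((0, b), 0) (y, 0))"
proof -
  define W where "W = (\<lambda>x. (\<Sum>b\<in>Basis. dirderiv (dirderiv \<Phi> ((b, 0), 0)) ((b, 0), 0) x) -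
    (\<Sum>b\<in>Basis. dirderiv (dirderiv \<Phi> ((0, b), 0)) ((0, b), 0) x))"
  have "continuous_on (- {0}) W"
    unfolding W_def
    by (intro continuous_intros Ck_on_2D(3)[OF C2, of "(y, 0)"])
      (use \<open>y \<noteq> 0\<close> in \<open>auto simp: Basis_prod_def zero_prod_def\<close>)
  then have "isCont W (y, 0)"
    using \<open>y \<noteq> 0\<close> by (simp add: continuous_on_eq_continuous_at open_Compl zero_prod_def)
  moreover have "((\<lambda>t. (y, t)) \<longlongrightarrow> (y, 0)) (at_right (0::real))"
    by (intro tendsto_intros)
  ultimately have "((\<lambda>t. W (y, t)) \<longlongrightarrow> W (y, 0)) (at_right 0)"
    by (rule isCont_tendsto_compose)
  \<comment> \<open>Since (y, t) = t (y/t, 1) and \<open>W\<close> has degree -1, the equation at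
    height 1 carries over to every height t > 0; continuity of \<open>W\<close> off the origin then
    reaches t = 0.\<close>
  moreover have "W (y, t) = 0" if "t > 0" for t
  proof -
    have "dirderiv (dirderiv \<Phi> b) b (y, t) = dirderiv (dirderiv \<Phi> b) b (y /\<^sub>R t, 1) / t"
      if "b \<in> Basis" for b
      using dirderiv2_homogeneous[OF hom C2 \<open>t > 0\<close> _ that, of "(y /\<^sub>R t, 1)" b] \<open>t > 0\<close>
      by (simp add: zero_prod_def)
    then have "W (y, t) = W (y /\<^sub>R t, 1) / t"
      by (simp add: W_def Basis_prod_def sum_divide_distrib diff_divide_distrib)
    also have "\<dots> = 0"
      using Phi_minimal_quadratic_imp_ultrahyperbolic[OF C2 min] by (simp add: W_def)
    finally show ?thesis .
  qed
  then have "\<forall>\<^sub>F t in at_right 0. W (y, t) = 0"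
    using eventually_at_right_less by (rule eventually_mono[rotated])
  ultimately have "((\<lambda>t. 0) \<longlongrightarrow> W (y, 0)) (at_right (0::real))"
    by (rule Lim_transform_eventually)
  then have "W (y, 0) = 0"
    by (simp add: tendsto_const_iff)
  then show ?thesis by (simp add: W_def)
qed

section \<open>Reduction to the singular ordinary differential equation\<close>

theorem mainTheorem3:
  fixes \<Phi> :: "((real^2) \<times> (real^2)) \<times> real \<Rightarrow> real"
  assumes "integrand \<Phi>"
    and "uniformly_elliptic \<Phi>"
    and "depends_on_radii \<Phi>"
  shows "\<not> Phi_minimal_on \<Phi>
    (\<lambda>(p, q). ((norm p)\<^sup>2 - (norm q)\<^sup>2) / 2) UNIV"
proof
  assume min: "Phi_minimal_on \<Phi> (\<lambda>(p, q). ((norm p)\<^sup>2 - (norm q)\<^sup>2) / 2) UNIV"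
  have hom: "one_homogeneous \<Phi>" and C2: "Ck_on 2 \<Phi> (- {0})"
    and pos: "\<And>\<nu>. \<nu> \<in> sphere 0 1 \<Longrightarrow> \<Phi> \<nu> > 0"
    using assms(1) by (auto simp: integrand_def C2_holder_sphere_def)
  obtain F where F: "\<And>p q z. \<Phi> ((p, q), z) = F (norm p) (norm q) z"
    using assms(3) by (auto simp: depends_on_radii_def)
  define e1 e2 :: "real^2" where "e1 = axis 1 1" and "e2 = axis 2 1"
  define E1 E2 F1 F2 :: "R4 \<times> real"
    where "E1 = ((e1, 0), 0)" and "E2 = ((e2, 0), 0)"
      and "F1 = ((0, e1), 0)" and "F2 = ((0, e2), 0)"
  note E_defs = E1_def E2_def F1_def F2_def
  have e: "e1 \<noteq> 0" "e2 \<noteq> 0" "e1 \<noteq> e2" "e1 \<in> Basis" "e2 \<in> Basis" "Basis = {e1, e2}"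
    by (simp_all add: e1_def e2_def Basis_real2 axis_eq_axis axis_eq_0_iff)
  have B: "E1 \<in> Basis" "E2 \<in> Basis" "F1 \<in> Basis" "F2 \<in> Basis"
    by (simp_all add: E_defs Basis_prod_def e)
  \<comment> \<open>\<open>P x\<close> is the point (x e1, e1, 0), which meets the light cone |p| =
    |q| at x = 1.\<close>
  define P where "P = (\<lambda>x. x *\<^sub>R E1 + F1)"
  have nzE: "F1 + x *\<^sub>R E1 + h *\<^sub>R E2 \<noteq> 0" for x h
    by (simp add: E_defs zero_prod_def e)
  have nzF: "x *\<^sub>R E1 + F1 + h *\<^sub>R F2 \<noteq> 0" if "x > 0" for x h
    using that by (simp add: E_defs zero_prod_def e)
  have nz: "P x \<noteq> 0" for x
    using nzE[of x 0] by (simp add: P_def add.commute)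
  note diff1 = Ck_on_2D(1)[OF C2] and diff2 = Ck_on_2D(2)[OF C2]
  have P': "(P has_vector_derivative E1) (at x)" for x
    unfolding P_def by (auto intro!: derivative_eq_intros)
  define g g' g'' where "g = (\<lambda>x. \<Phi> (P x))" and "g' = (\<lambda>x. dirderiv \<Phi> E1 (P x))"
    and "g'' = (\<lambda>x. dirderiv (dirderiv \<Phi> E1) E1 (P x))"
  have g''_eq: "dirderiv (dirderiv \<Phi> E1) E1 (P x) = g'' x" for x
    by (simp add: g''_def)
  have g: "(g has_real_derivative g' x) (at x)" for x
    unfolding g_def g'_def using P' nz by (intro DERIV_along_curve diff1) auto
  have g': "(g' has_real_derivative g'' x) (at x)" for x
    unfolding g'_def g''_def using P' nz B by (intro DERIV_along_curve diff2) auto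
  have "continuous_on UNIV g''"
    unfolding g''_def P_def using nz unfolding P_def
    by (intro continuous_on_compose2[OF Ck_on_2D(3)[OF C2]] B continuous_intros) auto
  then have g'': "isCont g'' 1"
    by (simp add: continuous_on_eq_continuous_at)
  \<comment> \<open>Rotation in the p-plane, where \<open>P x\<close> has radius x.\<close>
  have dE2: "dirderiv (dirderiv \<Phi> E2) E2 (P x) = g' x / x" if "x > 0" for x
  proof -
    have "dirderiv (dirderiv \<Phi> E2) E2 (F1 + x *\<^sub>R E1) = dirderiv \<Phi> E1 (F1 + x *\<^sub>R E1) / x"
    proof (rule dirderiv2_rotation_invariant)
      fix h \<theta> :: real
      show "\<Phi> (F1 + cos \<theta> *\<^sub>R (x *\<^sub>R E1 + h *\<^sub>R E2) + sin \<theta> *\<^sub>R (x *\<^sub>R E2 - h *\<^sub>R E1)) =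
          \<Phi> (F1 + x *\<^sub>R E1 + h *\<^sub>R E2)"
        using norm_rotation[of \<theta> x h] by (simp add: E_defs F e1_def e2_def)
    qed (use that nzE nzE[of x 0] B in \<open>auto intro!: diff1 diff2\<close>)
    then show ?thesis by (simp add: g'_def P_def add.commute)
  qed
  \<comment> \<open>Euler's relation at \<open>P x\<close> expresses the derivative along
    \<open>F1\<close> through \<open>g\<close> and \<open>g'\<close>.\<close>
  have dF1: "dirderiv \<Phi> F1 (P x) = g x - x * g' x" for x
  proof -
    have lin: "linear (\<lambda>v. dirderiv \<Phi> v (P x))"
      using nz by (intro dirderiv_linear diff1) auto
    have "x * dirderiv \<Phi> E1 (P x) + dirderiv \<Phi> F1 (P x) = dirderiv \<Phi> (x *\<^sub>R E1 + F1) (P x)"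
      by (simp add: linear_add[OF lin] linear_scale[OF lin])
    also have "\<dots> = \<Phi> (P x)"
      using euler_homogeneous[OF hom C2 nz[of x]] by (simp add: P_def)
    finally show ?thesis by (simp add: g_def g'_def)
  qed
  \<comment> \<open>Rotation in the q-plane, where \<open>P x\<close> has radius 1; the factor
    \<open>1 *\<^sub>R F1\<close> only fits the point to the shape of the rule.\<close>
  have dF2: "dirderiv (dirderiv \<Phi> F2) F2 (P x) = g x - x * g' x" if "x > 0" for x
  proof -
    have "dirderiv (dirderiv \<Phi> F2) F2 (x *\<^sub>R E1 + 1 *\<^sub>R F1) =
        dirderiv \<Phi> F1 (x *\<^sub>R E1 + 1 *\<^sub>R F1) / 1"
    proof (rule dirderiv2_rotation_invariant)
      fix h \<theta> :: real
      show "\<Phi> (x *\<^sub>R E1 + cos \<theta> *\<^sub>R (1 *\<^sub>R F1 + h *\<^sub>R F2) + sin \<theta> *\<^sub>R (1 *\<^sub>R F2 - h *\<^sub>R F1)) =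
          \<Phi> (x *\<^sub>R E1 + 1 *\<^sub>R F1 + h *\<^sub>R F2)"
        using norm_rotation[of \<theta> 1 h] by (simp add: E_defs F e1_def e2_def)
    qed (use that nz nzF B in \<open>auto intro!: diff1 diff2 simp: P_def\<close>)
    then show ?thesis by (simp add: P_def dF1[unfolded P_def])
  qed
  \<comment> \<open>First derivatives of \<open>\<Phi>\<close> have degree 0, so the one along
    \<open>F1\<close> at \<open>?Q t\<close> equals its value at \<open>P (x / t)\<close>, given by
    \<open>dF1\<close>. On differentiating at t = 1 the \<open>g'\<close> terms cancel.\<close>
  have dF1F1: "dirderiv (dirderiv \<Phi> F1) F1 (P x) = x\<^sup>2 * g'' x" for x
  proof -
    let ?Q = "\<lambda>t. x *\<^sub>R E1 + t *\<^sub>R F1"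
    have "((\<lambda>t. dirderiv \<Phi> F1 (?Q t)) has_real_derivative
        dirderiv (dirderiv \<Phi> F1) F1 (?Q 1)) (at 1)"
      using nz[of x] B
      by (intro DERIV_along_curve diff2) (auto intro!: derivative_eq_intros simp: P_def)
    then have "((\<lambda>t. g (x / t) - (x / t) * g' (x / t)) has_real_derivative
        dirderiv (dirderiv \<Phi> F1) F1 (?Q 1)) (at 1)"
    proof (rule has_field_derivative_transform_within_open[of _ _ _ "{0<..}"])
      fix t :: real assume t: "t \<in> {0<..}"
      then have "?Q t = t *\<^sub>R P (x / t)"
        by (simp add: P_def scaleR_add_right)
      then show "dirderiv \<Phi> F1 (?Q t) = g (x / t) - (x / t) * g' (x / t)"
        using dirderiv_homogeneous[OF hom C2] t nz dF1 by simp
    qed auto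
    moreover have "((\<lambda>t. g (x / t) - (x / t) * g' (x / t)) has_real_derivative x\<^sup>2 * g'' x) (at 1)"
      by (auto intro!: derivative_eq_intros DERIV_chain2[OF g] DERIV_chain2[OF g']
          simp: power2_eq_square algebra_simps)
    ultimately have "dirderiv (dirderiv \<Phi> F1) F1 (?Q 1) = x\<^sup>2 * g'' x"
      using DERIV_unique by blast
    then show ?thesis by (simp add: P_def)
  qed
  have "g 1 = 0"
  proof (rule C2_solution_vanishes_at_1[OF g g' g''])
    fix x :: real assume x: "x > 0"
    \<comment> \<open>In terms of \<open>g\<close> this says g'' + g'/x = x^2 g'' + (g - x
      g').\<close>
    have "dirderiv (dirderiv \<Phi> E1) E1 (P x) + dirderiv (dirderiv \<Phi> E2) E2 (P x) =
        dirderiv (dirderiv \<Phi> F1) F1 (P x) + dirderiv (dirderiv \<Phi> F2) F2 (P x)"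
      using ultrahyperbolic_at_infinity[OF hom C2 min, of "(x *\<^sub>R e1, e1)"] e(1,3)
      by (simp add: E_defs P_def zero_prod_def e(6))
    then show "(1 - x\<^sup>2) * g'' x + (x + 1 / x) * g' x - g x = 0"
      using dE2[OF x] dF1F1[of x] dF2[OF x] by (simp add: g''_eq algebra_simps)
  qed
  moreover have "g 1 > 0"
  proof -
    have "g 1 = norm (P 1) * \<Phi> (P 1 /\<^sub>R norm (P 1))"
      using one_homogeneousD[OF hom, of "norm (P 1)" "P 1 /\<^sub>R norm (P 1)"] nz[of 1]
      by (simp add: g_def)
    then show ?thesis
      using pos[of "P 1 /\<^sub>R norm (P 1)"] nz[of 1] by simp
  qed
  ultimately show False by simp
qed

end
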